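(* Among the ideals of the form $\mathcal{Z}_g$ with $g\in H$ there exists an antichain in the sense of $\leq_K$ of size $\mathfrak{c}$; that is, there is a family of $\mathfrak{c}$ many ideals of this form such that $\mathcal{I}\not\leq_K\mathcal{J}$ for any two distinct members $\mathcal{I},\mathcal{J}$ of the family.
   Context: $\omega=\{0,1,2,\ldots\}$ and $n\in\omega$ is identified with $\{0,\ldots,n-1\}$. $G$ is the set of all functions $g\colon\omega\to(0,\infty)$ such that $g(n)\to\infty$ and $\frac{n}{g(n)}\not\to 0$; $H=G\cap\omega^\omega$ is the set of those $g\in G$ with values in $\omega$. For $g\in G$, $\mathcal{Z}_g=\{A\subseteq\omega:\ \lim_{n\to\infty}\frac{\mathrm{card}(A\cap n)}{g(n)}=0\}$, which is an ideal on $\omega$. Katětov order: for ideals $\mathcal{I},\mathcal{J}$ on $\omega$, $\mathcal{I}\leq_K\mathcal{J}$ if there is a function $\phi\colon\omega\to\omega$ (not necessarily a bijection) such that for all $A\subseteq\omega$, $A\in\mathcal{I}$ implies $\phi^{-1}[A]\in\mathcal{J}$. $\mathfrak{c}$ is the cardinality of the continuum. *)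

theory Defs
  imports Complex_Main "HOL-Library.Equipollence"
begin

definition G :: "(nat \<Rightarrow> real) set" where
  "G = {g. (\<forall>n. 0 < g n) \<and> filterlim g at_top sequentially \<and>
           \<not> (\<lambda>n. real n / g n) \<longlonglongrightarrow> 0}"

text \<open>Functions with values in \<open>\<omega>\<close> are represented as real functions with values in \<open>\<nat>\<close>.\<close>

definition H :: "(nat \<Rightarrow> real) set" where
  "H = {g \<in> G. \<forall>n. g n \<in> \<nat>}"

text \<open>The natural number \<open>n\<close>, seen as a set, is \<open>{..<n}\<close>.\<close>

definition density_ideal :: "(nat \<Rightarrow> real) \<Rightarrow> nat set set" (\<open>\<Z>\<close>) where
  "\<Z> g = {A. (\<lambda>n. real (card (A \<inter> {..<n})) / g n) \<longlonglongrightarrow> 0}"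

definition katetov_le :: "nat set set \<Rightarrow> nat set set \<Rightarrow> bool" (infix \<open>\<le>\<^sub>K\<close> 50) where
  "I \<le>\<^sub>K J \<longleftrightarrow> (\<exists>\<phi> :: nat \<Rightarrow> nat. \<forall>A. A \<in> I \<longrightarrow> \<phi> -` A \<in> J)"

end

theory Submission
  imports Defs "HOL-Library.Countable"
begin

text \<open>
  Let \<open>a k = 2 ^ 3 ^ k\<close> (called \<open>lev k\<close> below) and \<open>m k = (a k)\<^sup>2\<close>. For an infinite \<open>X \<subseteq> \<omega>\<close> take a step function
  \<open>g\<close> with \<open>A \<in> \<Z> g\<close> iff \<open>card (A \<inter> m k) / a k \<rightarrow> 0\<close> along \<open>k \<in> X\<close>. If \<open>Y - X\<close> is infinite, then
  \<open>\<Z>\<close> of \<open>X\<close> is not Katetov below \<open>\<Z>\<close> of \<open>Y\<close>: given \<open>\<phi>\<close> and a large \<open>k \<in> Y - X\<close>, either a single fibre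
  of \<open>\<phi>\<close> has at least \<open>a k\<close> elements below \<open>m k\<close>, or \<open>a k\<close> many elements below \<open>m k\<close> are sent above
  \<open>m (k - 1)\<close>, because \<open>m k\<close> exceeds \<open>a k\<close> times \<open>m (k - 1)\<close>. In both cases a set that is negligible
  at the levels of \<open>X\<close> has a preimage of size at least \<open>a k\<close> below \<open>m k\<close>; the union of such sets
  for a sparse sequence of \<open>k \<in> Y - X\<close> refutes \<open>\<phi>\<close>. An almost disjoint family indexed by the
  reals, consisting of the graphs of \<open>n \<mapsto> \<lfloor>r n\<rfloor>\<close>, then yields the antichain.
\<close>

section \<open>Fast growing levels and step functions\<close>

definition lev :: "nat \<Rightarrow> nat" where
  "lev k = 2 ^ 3 ^ k"

text \<open>Chooses the block containing \<open>n\<close>. Blocks end at the numbers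
  \<open>(lev k)\<^sup>2\<close> with \<open>k\<close> in \<open>X\<close>, right end included; the
  minimum exists when \<open>X\<close> is infinite.\<close>

definition step_index :: "nat set \<Rightarrow> nat \<Rightarrow> nat" where
  "step_index X n = (LEAST k. k \<in> X \<and> n \<le> (lev k)\<^sup>2)"

definition step_fun :: "nat set \<Rightarrow> nat \<Rightarrow> real" where
  "step_fun X n = real (lev (step_index X n))"

text \<open>Cubing makes \<open>(lev k)\<^sup>2\<close> negligible against
  \<open>lev (Suc k)\<close>, by a factor \<open>lev k\<close>. Both growth estimates below rest on
  this.\<close>

lemma lev_Suc: "lev (Suc k) = lev k ^ 3"
  by (simp add: lev_def power_mult [symmetric] mult.commute)

lemma lev_ge_2: "2 \<le> lev k"
  using power_increasing [of 1 "3 ^ k" "2::nat"] by (simp add: lev_def)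

lemma lev_pos [simp]: "0 < lev k"
  by (simp add: lev_def)

lemma strict_mono_lev: "strict_mono lev"
  by (rule strict_monoI) (simp add: lev_def)

lemma lev_mono: "j \<le> k \<Longrightarrow> lev j \<le> lev k"
  by (simp add: strict_mono_less_eq [OF strict_mono_lev])

lemma le_lev: "k \<le> lev k"
  by (rule strict_mono_imp_increasing [OF strict_mono_lev])

lemma filterlim_lev: "filterlim (\<lambda>k. real (lev k)) at_top sequentially"
  by (rule filterlim_at_top_mono [OF filterlim_real_sequentially]) (simp add: le_lev)

lemma sum_lev_le: "(\<Sum>j<Suc k. lev j) + 1 \<le> (lev k)\<^sup>2"
proof (induction k)
  case 0
  show ?case by (simp add: lev_def)
next
  case (Suc k)
  have "(lev k)\<^sup>2 \<le> lev (Suc k)"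
    unfolding lev_Suc by (rule power_increasing) (use lev_ge_2 [of k] in auto)
  with Suc have "(\<Sum>j<Suc (Suc k). lev j) + 1 \<le> 2 * lev (Suc k)"
    by simp
  also have "\<dots> \<le> (lev (Suc k))\<^sup>2"
    using lev_ge_2 [of "Suc k"] by (simp add: power2_eq_square)
  finally show ?case .
qed

text \<open>Serves the pigeonhole count below \<open>(lev (Suc k))\<^sup>2\<close>: even after
  \<open>(lev k)\<^sup>2 + 1\<close> portions of \<open>lev (Suc k)\<close> points are removed, one
  full portion remains.\<close>

lemma lev_sq_ge: "lev (Suc k) * ((lev k)\<^sup>2 + 2) \<le> (lev (Suc k))\<^sup>2"
proof -
  have "2 * 2 \<le> lev k * lev k"
    by (intro mult_le_mono lev_ge_2)
  then have "(lev k)\<^sup>2 + 2 \<le> 2 * (lev k)\<^sup>2"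
    by (simp add: power2_eq_square)
  also have "\<dots> \<le> lev k * (lev k)\<^sup>2"
    by (intro mult_le_mono lev_ge_2) simp
  also have "\<dots> = lev (Suc k)"
    by (simp add: lev_Suc power2_eq_square power3_eq_cube)
  finally show ?thesis
    by (simp only: power2_eq_square [of "lev (Suc k)"] mult_le_mono2)
qed

lemma le_lev_sq: "k \<le> (lev k)\<^sup>2"
  using le_lev [of k] power2_nat_le_imp_le [of "lev k"] self_le_power [of "lev k" 2] lev_pos [of k]
  by (auto intro: order_trans)

section \<open>Density along the levels in \<open>X\<close>\<close>

lemma step_index:
  assumes "infinite X"
  shows "step_index X n \<in> X" and "n \<le> (lev (step_index X n))\<^sup>2"
proof -
  obtain k where "k \<in> X" "n \<le> k"
    using assms infinite_nat_iff_unbounded_le by blast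
  then have "k \<in> X \<and> n \<le> (lev k)\<^sup>2"
    using le_lev_sq [of k] by linarith
  then have "step_index X n \<in> X \<and> n \<le> (lev (step_index X n))\<^sup>2"
    unfolding step_index_def by (rule LeastI)
  then show "step_index X n \<in> X" and "n \<le> (lev (step_index X n))\<^sup>2"
    by auto
qed

lemma step_index_lev_sq:
  assumes "k \<in> X"
  shows "step_index X ((lev k)\<^sup>2) = k"
  unfolding step_index_def
proof (rule Least_equality)
  fix j
  assume "j \<in> X \<and> (lev k)\<^sup>2 \<le> (lev j)\<^sup>2"
  then show "k \<le> j"
    by (simp add: strict_mono_less_eq [OF strict_mono_lev])
qed (use assms in simp)

lemma filterlim_step_index:
  assumes "infinite X"
  shows "filterlim (step_index X) (inf sequentially (principal X)) sequentially"
  unfolding filterlim_inf filterlim_principal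
proof (intro conjI)
  show "filterlim (step_index X) sequentially sequentially"
    unfolding filterlim_at_top
  proof (intro allI eventually_sequentiallyI)
    fix K n :: nat
    assume n: "Suc ((lev K)\<^sup>2) \<le> n"
    show "K \<le> step_index X n"
    proof (rule ccontr)
      assume "\<not> K \<le> step_index X n"
      then have "(lev (step_index X n))\<^sup>2 \<le> (lev K)\<^sup>2"
        by (simp add: lev_mono)
      with n step_index(2) [OF assms, of n] show False
        by linarith
    qed
  qed
qed (use step_index(1) [OF assms] in simp)

lemma filterlim_lev_sq: "filterlim (\<lambda>k. (lev k)\<^sup>2) sequentially sequentially"
  by (rule filterlim_at_top_mono [OF filterlim_ident]) (simp add: le_lev_sq)

text \<open>On a block the denominator is constant and the numerator grows with \<open>n\<close>, so
  the quotient is largest at the right end. The filter \<open>inf sequentially (principal X)\<close>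
  expresses that \<open>k\<close> tends to infinity within \<open>X\<close>.\<close>

lemma mem_density_ideal_step_fun_iff:
  assumes "infinite X"
  shows "A \<in> \<Z> (step_fun X) \<longleftrightarrow>
    ((\<lambda>k. real (card (A \<inter> {..<(lev k)\<^sup>2})) / real (lev k)) \<longlongrightarrow> 0) (inf sequentially (principal X))"
    (is "_ \<longleftrightarrow> (?f \<longlongrightarrow> 0) ?F")
proof
  assume "A \<in> \<Z> (step_fun X)"
  then have "(\<lambda>n. real (card (A \<inter> {..<n})) / step_fun X n) \<longlonglongrightarrow> 0"
    by (simp add: density_ideal_def)
  from filterlim_compose [OF this filterlim_lev_sq]
  have "((\<lambda>k. real (card (A \<inter> {..<(lev k)\<^sup>2})) / step_fun X ((lev k)\<^sup>2)) \<longlongrightarrow> 0) ?F"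
    by (rule filterlim_mono) auto
  then show "(?f \<longlongrightarrow> 0) ?F"
    by (rule Lim_transform_eventually)
       (simp add: eventually_inf_principal step_fun_def step_index_lev_sq)
next
  assume "(?f \<longlongrightarrow> 0) ?F"
  then have lim: "(\<lambda>n. ?f (step_index X n)) \<longlonglongrightarrow> 0"
    by (rule filterlim_compose [OF _ filterlim_step_index [OF assms]])
  have "(\<lambda>n. real (card (A \<inter> {..<n})) / step_fun X n) \<longlonglongrightarrow> 0"
  proof (rule tendsto_sandwich [OF _ _ tendsto_const lim])
    show "\<forall>\<^sub>F n in sequentially. real (card (A \<inter> {..<n})) / step_fun X n \<le> ?f (step_index X n)"
    proof (intro always_eventually allI)
      fix n
      have "card (A \<inter> {..<n}) \<le> card (A \<inter> {..<(lev (step_index X n))\<^sup>2})"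
        using step_index(2) [OF assms, of n] by (intro card_mono) auto
      then show "real (card (A \<inter> {..<n})) / step_fun X n \<le> ?f (step_index X n)"
        by (simp add: step_fun_def divide_right_mono)
    qed
  qed (simp add: step_fun_def)
  then show "A \<in> \<Z> (step_fun X)"
    by (simp add: density_ideal_def)
qed

lemma step_fun_in_H:
  assumes "infinite X"
  shows "step_fun X \<in> H"
proof -
  have "filterlim (step_fun X) at_top sequentially"
    unfolding step_fun_def
    using filterlim_step_index [OF assms] filterlim_lev filterlim_compose
    by (auto simp: filterlim_inf)
  moreover have "\<not> (\<lambda>n. real n / step_fun X n) \<longlonglongrightarrow> 0"
  proof
    assume "(\<lambda>n. real n / step_fun X n) \<longlonglongrightarrow> 0"
    then obtain N where N: "\<And>n. n \<ge> N \<Longrightarrow> real n / step_fun X n < 1"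
      using order_tendstoD(2) [of _ 0 sequentially 1] by (fastforce simp: eventually_sequentially)
    obtain k where k: "k \<in> X" "N \<le> k"
      using assms infinite_nat_iff_unbounded_le by blast
    then have "real ((lev k)\<^sup>2) / step_fun X ((lev k)\<^sup>2) < 1"
      using le_lev_sq [of k] by (intro N) linarith
    moreover have "step_fun X ((lev k)\<^sup>2) = real (lev k)"
      using k by (simp add: step_fun_def step_index_lev_sq)
    ultimately have "real (lev k) < 1"
      by (simp add: power2_eq_square)
    with lev_ge_2 [of k] show False
      by simp
  qed
  ultimately show ?thesis
    by (simp add: H_def G_def step_fun_def)
qed

section \<open>Failure of Katetov reductions\<close>

text \<open>At a level outside \<open>X\<close>, the set \<open>S\<close> costs at most one point for the levels of \<open>X\<close> below.\<close>

lemma large_preimage: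
  fixes \<phi> :: "nat \<Rightarrow> nat"
  assumes few: "card (\<phi> -` {..<n} \<inter> {..<(lev (Suc k))\<^sup>2}) < lev (Suc k)"
  obtains S where "finite S" "S \<subseteq> {n..}" "card S \<le> lev (Suc k)"
    "card (S \<inter> {..<(lev k)\<^sup>2}) \<le> 1" "lev (Suc k) \<le> card (\<phi> -` S \<inter> {..<(lev (Suc k))\<^sup>2})"
proof (cases "\<exists>p\<ge>n. lev (Suc k) \<le> card (\<phi> -` {p} \<inter> {..<(lev (Suc k))\<^sup>2})")
  case True
  then obtain p where "n \<le> p" "lev (Suc k) \<le> card (\<phi> -` {p} \<inter> {..<(lev (Suc k))\<^sup>2})"
    by blast
  moreover have "card ({p} \<inter> {..<(lev k)\<^sup>2}) \<le> 1"
    using card_mono [of "{p}" "{p} \<inter> {..<(lev k)\<^sup>2}"] by simp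
  ultimately show ?thesis
    using that [of "{p}"] lev_ge_2 [of "Suc k"] by simp
next
  case False
  define a where "a = lev (Suc k)"
  define m where "m = (lev k)\<^sup>2"
  let ?M = "{..<a\<^sup>2}"
  let ?T = "{i \<in> ?M. max n m \<le> \<phi> i}"
  \<comment> \<open>A point of \<open>?M\<close> is sent below \<open>n\<close>, into one of the at
    most \<open>m\<close> fibres over \<open>{n..<m}\<close>, each now smaller than
    \<open>a\<close>, or to \<open>max n m\<close> and beyond.\<close>
  have "?M \<subseteq> (\<phi> -` {..<n} \<inter> ?M) \<union> (\<Union>p\<in>{n..<m}. \<phi> -` {p} \<inter> ?M) \<union> ?T"
    by (auto simp: not_le)
  then have "card ?M \<le> card ((\<phi> -` {..<n} \<inter> ?M) \<union> (\<Union>p\<in>{n..<m}. \<phi> -` {p} \<inter> ?M) \<union> ?T)"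
    by (intro card_mono) auto
  also have "\<dots> \<le> card (\<phi> -` {..<n} \<inter> ?M) + card (\<Union>p\<in>{n..<m}. \<phi> -` {p} \<inter> ?M) + card ?T"
    by (meson add_le_mono1 card_Un_le order_trans)
  also have "\<dots> \<le> a + m * a + card ?T"
  proof (intro add_le_mono order_refl)
    show "card (\<phi> -` {..<n} \<inter> ?M) \<le> a"
      using few by (simp add: a_def)
    have "card (\<Union>p\<in>{n..<m}. \<phi> -` {p} \<inter> ?M) \<le> (\<Sum>p\<in>{n..<m}. card (\<phi> -` {p} \<inter> ?M))"
      by (rule card_UN_le) simp
    also have "\<dots> \<le> of_nat (card {n..<m}) * a"
    proof (rule sum_bounded_above)
      fix p
      assume "p \<in> {n..<m}"
      then have "\<not> a \<le> card (\<phi> -` {p} \<inter> ?M)"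
        using False by (auto simp: a_def)
      then show "card (\<phi> -` {p} \<inter> ?M) \<le> a"
        by simp
    qed
    also have "\<dots> \<le> m * a"
      by simp
    finally show "card (\<Union>p\<in>{n..<m}. \<phi> -` {p} \<inter> ?M) \<le> m * a" .
  qed
  finally have "a\<^sup>2 \<le> a + m * a + card ?T"
    by simp
  moreover have "a * (m + 2) \<le> a\<^sup>2"
    unfolding a_def m_def by (rule lev_sq_ge)
  ultimately have "a \<le> card ?T"
    by (simp add: algebra_simps)
  \<comment> \<open>Exactly \<open>a\<close> points are kept so that the image has at most
    \<open>a\<close> points; \<phi> need not be injective on \<open>T\<close>, as only the preimage
    must be large.\<close>
  then obtain T where T: "T \<subseteq> ?T" "card T = a" "finite T"
    by (rule obtain_subset_with_card_n)
  show ?thesis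
  proof (rule that [of "\<phi> ` T"])
    show "card (\<phi> ` T) \<le> lev (Suc k)"
      using T card_image_le [of T \<phi>] by (simp add: a_def)
    have "\<phi> ` T \<inter> {..<(lev k)\<^sup>2} = {}"
      using T by (fastforce simp: m_def)
    then show "card (\<phi> ` T \<inter> {..<(lev k)\<^sup>2}) \<le> 1"
      by simp
    have "card T \<le> card (\<phi> -` (\<phi> ` T) \<inter> ?M)"
      using T by (intro card_mono) auto
    then show "lev (Suc k) \<le> card (\<phi> -` (\<phi> ` T) \<inter> {..<(lev (Suc k))\<^sup>2})"
      using T by (simp add: a_def)
  qed (use T in auto)
qed

lemma finite_in_density_ideal_step_fun:
  assumes "infinite X" "finite A"
  shows "A \<in> \<Z> (step_fun X)"
proof -
  have lim: "(\<lambda>k. real (card A) / real (lev k)) \<longlonglongrightarrow> 0"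
    by (rule tendsto_divide_0 [OF tendsto_const])
       (rule filterlim_at_top_imp_at_infinity [OF filterlim_lev])
  have "(\<lambda>k. real (card (A \<inter> {..<(lev k)\<^sup>2})) / real (lev k)) \<longlonglongrightarrow> 0"
    using assms by (intro tendsto_sandwich [OF _ _ tendsto_const lim] always_eventually allI)
      (auto intro!: divide_right_mono card_mono)
  then show ?thesis
    unfolding mem_density_ideal_step_fun_iff [OF assms(1)]
    by (rule filterlim_mono) auto
qed

text \<open>For \<open>x = Suc k\<close> the bound is at most \<open>(lev k)\<^sup>2\<close>, and
  division by \<open>lev x\<close>, the cube of \<open>lev k\<close>, leaves at most
  \<open>1 / lev k\<close>.\<close>

lemma in_density_ideal_step_funI:
  assumes "infinite X"
    and bound: "\<And>x. x \<in> X \<Longrightarrow> card (A \<inter> {..<(lev x)\<^sup>2}) \<le> (\<Sum>j<x. lev j) + 1"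
  shows "A \<in> \<Z> (step_fun X)"
  unfolding mem_density_ideal_step_fun_iff [OF assms(1)]
proof (rule tendsto_sandwich [OF _ _ tendsto_const])
  let ?b = "\<lambda>x. real ((\<Sum>j<x. lev j) + 1) / real (lev x)"
  have lim: "(\<lambda>k. 1 / real (lev k)) \<longlonglongrightarrow> 0"
    by (rule tendsto_divide_0 [OF tendsto_const])
       (rule filterlim_at_top_imp_at_infinity [OF filterlim_lev])
  have "(\<lambda>k. ?b (Suc k)) \<longlonglongrightarrow> 0"
  proof (rule tendsto_sandwich [OF _ _ tendsto_const lim])
    show "\<forall>\<^sub>F k in sequentially. ?b (Suc k) \<le> 1 / real (lev k)"
    proof (intro always_eventually allI)
      fix k
      have "?b (Suc k) \<le> real ((lev k)\<^sup>2) / real (lev (Suc k))"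
        by (intro divide_right_mono of_nat_mono sum_lev_le) simp
      also have "\<dots> = 1 / real (lev k)"
        using lev_pos [of k] by (simp add: lev_Suc power2_eq_square power3_eq_cube)
      finally show "?b (Suc k) \<le> 1 / real (lev k)" .
    qed
  qed (intro always_eventually allI divide_nonneg_nonneg of_nat_0_le_iff)
  then have "?b \<longlonglongrightarrow> 0"
    by (rule LIMSEQ_imp_Suc)
  then show "(?b \<longlongrightarrow> 0) (inf sequentially (principal X))"
    by (rule filterlim_mono) auto
  show "\<forall>\<^sub>F x in inf sequentially (principal X).
      real (card (A \<inter> {..<(lev x)\<^sup>2})) / real (lev x) \<le> ?b x"
    unfolding eventually_inf_principal
    by (intro always_eventually allI impI divide_right_mono of_nat_mono bound) simp_all
qed simp

lemma not_katetov_le_step_fun: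
  assumes X: "infinite X" and YX: "infinite (Y - X)"
  shows "\<not> \<Z> (step_fun X) \<le>\<^sub>K \<Z> (step_fun Y)"
proof
  assume "\<Z> (step_fun X) \<le>\<^sub>K \<Z> (step_fun Y)"
  then obtain \<phi> where \<phi>: "\<And>A. A \<in> \<Z> (step_fun X) \<Longrightarrow> \<phi> -` A \<in> \<Z> (step_fun Y)"
    unfolding katetov_le_def by blast
  have Y: "infinite Y"
    using YX by (meson finite_Diff)
  have small: "\<exists>N. \<forall>k\<ge>N. k \<in> Y \<longrightarrow> card (\<phi> -` A \<inter> {..<(lev k)\<^sup>2}) < lev k"
    if "A \<in> \<Z> (step_fun X)" for A
  proof -
    have "((\<lambda>k. real (card (\<phi> -` A \<inter> {..<(lev k)\<^sup>2})) / real (lev k)) \<longlongrightarrow> 0)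
        (inf sequentially (principal Y))"
      using \<phi> [OF that] mem_density_ideal_step_fun_iff [OF Y] by blast
    from order_tendstoD(2) [OF this, of 1] show ?thesis
      by (simp add: eventually_inf_principal eventually_sequentially)
  qed
  have "\<exists>k S. Suc k \<in> Y - X \<and> l \<le> k \<and> finite S \<and> S \<subseteq> {(lev l)\<^sup>2..} \<and> card S \<le> lev (Suc k) \<and>
      card (S \<inter> {..<(lev k)\<^sup>2}) \<le> 1 \<and>
      lev (Suc k) \<le> card (\<phi> -` S \<inter> {..<(lev (Suc k))\<^sup>2})" for l
  proof -
    have "{..<(lev l)\<^sup>2} \<in> \<Z> (step_fun X)"
      by (rule finite_in_density_ideal_step_fun [OF X]) simp
    then obtain N where N: "\<And>k. k \<ge> N \<Longrightarrow> k \<in> Y \<Longrightarrow>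
        card (\<phi> -` {..<(lev l)\<^sup>2} \<inter> {..<(lev k)\<^sup>2}) < lev k"
      using small by blast
    \<comment> \<open>\<open>Suc l\<close> makes \<open>k'\<close> a successor whose predecessor is
      still at least \<open>l\<close>.\<close>
    obtain k' where k': "k' \<in> Y - X" "max N (Suc l) \<le> k'"
      using YX infinite_nat_iff_unbounded_le by blast
    then obtain k where k: "k' = Suc k"
      by (cases k') auto
    have "card (\<phi> -` {..<(lev l)\<^sup>2} \<inter> {..<(lev (Suc k))\<^sup>2}) < lev (Suc k)"
      using k k' by (intro N) auto
    then obtain S where "finite S" "S \<subseteq> {(lev l)\<^sup>2..}" "card S \<le> lev (Suc k)"
      "card (S \<inter> {..<(lev k)\<^sup>2}) \<le> 1" "lev (Suc k) \<le> card (\<phi> -` S \<inter> {..<(lev (Suc k))\<^sup>2})"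
      by (rule large_preimage)
    then show ?thesis
      using k k' by (intro exI [of _ k] exI [of _ S]) auto
  qed
  then obtain nxt S where nxt: "\<And>l. Suc (nxt l) \<in> Y - X" "\<And>l. l \<le> nxt l"
    and S: "\<And>l. finite (S l)" "\<And>l. S l \<subseteq> {(lev l)\<^sup>2..}" "\<And>l. card (S l) \<le> lev (Suc (nxt l))"
      "\<And>l. card (S l \<inter> {..<(lev (nxt l))\<^sup>2}) \<le> 1"
      "\<And>l. lev (Suc (nxt l)) \<le> card (\<phi> -` S l \<inter> {..<(lev (Suc (nxt l)))\<^sup>2})"
    by metis
  \<comment> \<open>Each piece \<open>S (\<kappa> i)\<close> starts at or above
    \<open>(lev (\<kappa> i))\<^sup>2\<close> and has a large preimage at level
    \<open>\<kappa> (Suc i)\<close>, which lies in \<open>Y - X\<close>.\<close>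
  define \<kappa> where "\<kappa> = rec_nat 0 (\<lambda>_ l. Suc (nxt l))"
  have \<kappa>_0: "\<kappa> 0 = 0" and \<kappa>_Suc: "\<kappa> (Suc i) = Suc (nxt (\<kappa> i))" for i
    by (simp_all add: \<kappa>_def)
  have \<kappa>: "strict_mono \<kappa>"
    unfolding strict_mono_Suc_iff by (simp add: \<kappa>_Suc nxt(2) less_Suc_eq_le)
  define A where "A = (\<Union>i. S (\<kappa> i))"
  have "A \<in> \<Z> (step_fun X)"
  proof (rule in_density_ideal_step_funI [OF X])
    fix x
    assume x: "x \<in> X"
    \<comment> \<open>Locates \<open>x\<close> between \<open>\<kappa> i\<close> and
      \<open>\<kappa> (Suc i)\<close>. Since \<open>x\<close> is in \<open>X\<close>, it differs
      from every \<open>\<kappa> (Suc j)\<close>, which gives the strict inequality in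
      \<open>x_ge\<close>.\<close>
    define i where "i = (LEAST i. x < \<kappa> (Suc i))"
    have "x < \<kappa> (Suc x)"
      using strict_mono_imp_increasing [OF \<kappa>, of "Suc x"] by simp
    then have x_less: "x < \<kappa> (Suc i)"
      unfolding i_def by (rule LeastI)
    have x_ge: "\<kappa> (Suc j) < x" if "j < i" for j
    proof -
      have "\<kappa> (Suc j) \<le> x"
        using not_less_Least [of j "\<lambda>i. x < \<kappa> (Suc i)"] that by (simp add: i_def)
      moreover have "\<kappa> (Suc j) \<noteq> x"
        using nxt(1) [of "\<kappa> j"] x by (auto simp: \<kappa>_Suc)
      ultimately show ?thesis by simp
    qed
    have far: "S (\<kappa> j) \<inter> {..<(lev x)\<^sup>2} = {}" if "i < j" for j
    proof -
      have "\<kappa> (Suc i) \<le> \<kappa> j"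
        using that by (simp add: strict_mono_less_eq [OF \<kappa>])
      with x_less have "(lev x)\<^sup>2 \<le> (lev (\<kappa> j))\<^sup>2"
        by (simp add: lev_mono)
      moreover have "{b..} \<inter> {..<c} = {}" if "c \<le> b" for b c :: nat
        using that by auto
      ultimately have "{(lev (\<kappa> j))\<^sup>2..} \<inter> {..<(lev x)\<^sup>2} = {}"
        by blast
      with S(2) [of "\<kappa> j"] show ?thesis
        by blast
    qed
    \<comment> \<open>Pieces before \<open>i\<close> are counted in full, later ones lie too high,
      and piece \<open>i\<close> contributes at most one point because
      \<open>x \<le> nxt (\<kappa> i)\<close>.\<close>
    have "A \<inter> {..<(lev x)\<^sup>2} \<subseteq> (\<Union>j<i. S (\<kappa> j)) \<union> (S (\<kappa> i) \<inter> {..<(lev (nxt (\<kappa> i)))\<^sup>2})"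
    proof
      fix y
      assume y: "y \<in> A \<inter> {..<(lev x)\<^sup>2}"
      then obtain j where j: "y \<in> S (\<kappa> j)"
        by (auto simp: A_def)
      have "lev x \<le> lev (nxt (\<kappa> i))"
        using x_less by (simp add: \<kappa>_Suc lev_mono)
      then have "(lev x)\<^sup>2 \<le> (lev (nxt (\<kappa> i)))\<^sup>2"
        by simp
      with y have "y < (lev (nxt (\<kappa> i)))\<^sup>2"
        by (meson IntD2 lessThan_iff less_le_trans)
      moreover have "j \<le> i"
        using far [of j] j y by (metis IntD2 IntI empty_iff not_le)
      ultimately show "y \<in> (\<Union>j<i. S (\<kappa> j)) \<union> (S (\<kappa> i) \<inter> {..<(lev (nxt (\<kappa> i)))\<^sup>2})"
        using j by (cases "j = i") auto
    qed
    then have "card (A \<inter> {..<(lev x)\<^sup>2})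
        \<le> card ((\<Union>j<i. S (\<kappa> j)) \<union> (S (\<kappa> i) \<inter> {..<(lev (nxt (\<kappa> i)))\<^sup>2}))"
      using S(1) by (intro card_mono) auto
    also have "\<dots> \<le> card (\<Union>j<i. S (\<kappa> j)) + card (S (\<kappa> i) \<inter> {..<(lev (nxt (\<kappa> i)))\<^sup>2})"
      by (rule card_Un_le)
    also have "\<dots> \<le> (\<Sum>j<x. lev j) + 1"
    proof (rule add_le_mono [OF _ S(4)])
      have "card (\<Union>j<i. S (\<kappa> j)) \<le> (\<Sum>j<i. card (S (\<kappa> j)))"
        by (rule card_UN_le) simp
      also have "\<dots> \<le> (\<Sum>j<i. lev (\<kappa> (Suc j)))"
        using S(3) by (intro sum_mono) (simp add: \<kappa>_Suc)
      \<comment> \<open>The indices \<open>\<kappa> (Suc j)\<close> are distinct and below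
        \<open>x\<close>, so their levels form part of the sum over all
        \<open>j < x\<close>.\<close>
      also have "\<dots> = sum lev ((\<lambda>j. \<kappa> (Suc j)) ` {..<i})"
        by (subst sum.reindex) (auto simp: inj_on_def strict_mono_eq [OF \<kappa>])
      also have "\<dots> \<le> (\<Sum>j<x. lev j)"
        using x_ge by (intro sum_mono2) auto
      finally show "card (\<Union>j<i. S (\<kappa> j)) \<le> (\<Sum>j<x. lev j)" .
    qed
    finally show "card (A \<inter> {..<(lev x)\<^sup>2}) \<le> (\<Sum>j<x. lev j) + 1" .
  qed
  then obtain N where N: "\<And>k. k \<ge> N \<Longrightarrow> k \<in> Y \<Longrightarrow> card (\<phi> -` A \<inter> {..<(lev k)\<^sup>2}) < lev k"
    using small by blast
  \<comment> \<open>At the level \<open>\<kappa> (Suc N)\<close> in \<open>Y\<close> the piece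
    \<open>S (\<kappa> N)\<close> alone violates the smallness of the preimage of
    \<open>A\<close>.\<close>
  have "N \<le> \<kappa> (Suc N)"
    using strict_mono_imp_increasing [OF \<kappa>, of "Suc N"] by simp
  then have "card (\<phi> -` A \<inter> {..<(lev (\<kappa> (Suc N)))\<^sup>2}) < lev (\<kappa> (Suc N))"
    using nxt(1) by (intro N) (auto simp: \<kappa>_Suc)
  moreover have "card (\<phi> -` S (\<kappa> N) \<inter> {..<(lev (\<kappa> (Suc N)))\<^sup>2})
      \<le> card (\<phi> -` A \<inter> {..<(lev (\<kappa> (Suc N)))\<^sup>2})"
    by (intro card_mono) (auto simp: A_def)
  ultimately show False
    using S(5) [of "\<kappa> N"] by (simp add: \<kappa>_Suc)
qed

section \<open>An almost disjoint family indexed by the reals\<close>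

definition floor_graph :: "real \<Rightarrow> nat set" where
  "floor_graph r = range (\<lambda>n::nat. to_nat (n, \<lfloor>r * real n\<rfloor>))"

lemma infinite_floor_graph: "infinite (floor_graph r)"
  unfolding floor_graph_def by (rule range_inj_infinite) (auto simp: inj_on_def)

text \<open>Once \<open>n\<close> reaches \<open>1 / \<bar>r - s\<bar>\<close>, the numbers
  \<open>r * n\<close> and \<open>s * n\<close> are at least 1 apart and have different floors, so
  the graphs share only finitely many points.\<close>

lemma infinite_floor_graph_Diff:
  assumes "r \<noteq> s"
  shows "infinite (floor_graph r - floor_graph s)"
proof -
  obtain N :: nat where N: "1 / \<bar>r - s\<bar> \<le> real N"
    using real_arch_simple by blast
  have neq: "\<lfloor>r * real n\<rfloor> \<noteq> \<lfloor>s * real n\<rfloor>" if "N \<le> n" for n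
  proof
    assume "\<lfloor>r * real n\<rfloor> = \<lfloor>s * real n\<rfloor>"
    then have "\<bar>r * real n - s * real n\<bar> < 1"
      by linarith
    then have "\<bar>r - s\<bar> * real n < 1"
      by (simp add: left_diff_distrib [symmetric] abs_mult)
    moreover have "1 / \<bar>r - s\<bar> \<le> real n"
      using N that by linarith
    ultimately show False
      using assms by (simp add: field_simps)
  qed
  have "infinite ((\<lambda>n. to_nat (n, \<lfloor>r * real n\<rfloor>)) ` {N..})"
    by (subst finite_image_iff) (auto simp: inj_on_def infinite_Ici)
  moreover have "(\<lambda>n. to_nat (n, \<lfloor>r * real n\<rfloor>)) ` {N..} \<subseteq> floor_graph r - floor_graph s"
    using neq by (auto simp: floor_graph_def)
  ultimately show ?thesis
    using finite_subset by blast
qed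

lemma katetov_le_refl: "I \<le>\<^sub>K I"
  unfolding katetov_le_def by (rule exI [of _ id]) simp

theorem theorem3:
  shows "\<exists>\<F>. \<F> \<subseteq> \<Z> ` H \<and> \<F> \<approx> (UNIV :: real set) \<and>
    (\<forall>I \<in> \<F>. \<forall>J \<in> \<F>. I \<noteq> J \<longrightarrow> \<not> I \<le>\<^sub>K J)"
proof -
  define Zr where "Zr r = \<Z> (step_fun (floor_graph r))" for r
  have incomparable: "\<not> Zr r \<le>\<^sub>K Zr s" if "r \<noteq> s" for r s
    unfolding Zr_def
    by (rule not_katetov_le_step_fun [OF infinite_floor_graph infinite_floor_graph_Diff])
       (use that in simp)
  \<comment> \<open>Equal ideals are comparable by reflexivity, so incomparability also yields that
    the family has the size of the reals.\<close>
  have "inj Zr"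
    by (rule injI) (metis incomparable katetov_le_refl)
  then have "range Zr \<approx> (UNIV :: real set)"
    by (rule inj_on_image_eqpoll_self)
  moreover have "range Zr \<subseteq> \<Z> ` H"
    by (auto simp: Zr_def step_fun_in_H infinite_floor_graph)
  moreover have "\<forall>I \<in> range Zr. \<forall>J \<in> range Zr. I \<noteq> J \<longrightarrow> \<not> I \<le>\<^sub>K J"
    by (metis incomparable rangeE)
  ultimately show ?thesis
    by blast
qed

end
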